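(* (In LZFC.) Let $M$ be a strongly extendible model. Then: (i) $M\prec_{\Sigma_1} V$. Therefore, in ${\rm LZFC}^{sext}$ every set belongs to some model $M$ with $M\prec_{\Sigma_1} V$. (ii) Actually $M\prec_{\Sigma_2}V$.
   Context: All theories are in the language $\{\in\}$. BST is the theory with axioms: Empty set, Extensionality, Pair, Union, Cartesian Product, "$\omega$ exists", $\Delta_0$-Separation. $Loc({\rm ZFC})$ is the statement that every set belongs to a transitive model of ZFC; ${\rm LZFC}={\rm BST}+Loc({\rm ZFC})$. "Model" means a (set) transitive model of ZFC. A model $M$ is strongly extendible if for every set $x$ there is a model $N$ such that $x\in N$ and $M\prec N$. $Loc^{sext}({\rm ZFC})$ says that every set belongs to a strongly extendible model, and ${\rm LZFC}^{sext}={\rm LZFC}+Loc^{sext}({\rm ZFC})$. A $\Sigma_n$ formula is one of the form $(\exists \overline{x}_1)(\forall \overline{x}_2)\cdots (Q \overline{x}_n)\psi$ with $\psi$ bounded and the $\overline{x}_i$ tuples of variables. $M\prec_{\Sigma_n}V$ means that for every $\Sigma_n$ sentence $\phi$ with parameters from $M$, $M\models\phi$ iff $\phi$ is true in the universe $V$. *)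

theory Defs
  imports Main
begin

text \<open>
  A theorem of a first-order theory in the language of set theory is stated here as a statement
  about an arbitrary structure \<open>(V, E)\<close> satisfying that theory, where \<open>V\<close> is an arbitrary type
  (by the completeness theorem this is the same as provability).  Neither \<open>E\<close> nor the
  \<open>\<omega>\<close> of the structure need be well-founded from outside.  Hence two kinds of formulas occur:
  \<^item> metatheoretic formulas, the elements of the type \<open>fm\<close> below.  They make up the
    schema of bounded separation and the \<open>\<Sigma>\<^sub>n\<close> formulas whose truth in \<open>V\<close> is considered;
  \<^item> codes of formulas, which are elements of \<open>V\<close>.  Statements made inside the theory about
    models (being a model of ZFC, elementary extension) concern all codes, including
    nonstandard ones, and use the satisfaction relation as defined inside the theory.

  All definitions that are parts of axioms quantify over elements of \<open>V\<close> only.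
\<close>

section \<open>Metatheoretic formulas\<close>

datatype fm =
    FMem nat nat
  | FEq nat nat
  | FNeg fm
  | FAnd fm fm
  | FEx nat fm

definition FOr :: "fm \<Rightarrow> fm \<Rightarrow> fm" where
  "FOr p q = FNeg (FAnd (FNeg p) (FNeg q))"

definition FImp :: "fm \<Rightarrow> fm \<Rightarrow> fm" where
  "FImp p q = FNeg (FAnd p (FNeg q))"

definition FIff :: "fm \<Rightarrow> fm \<Rightarrow> fm" where
  "FIff p q = FAnd (FImp p q) (FImp q p)"

definition FAll :: "nat \<Rightarrow> fm \<Rightarrow> fm" where
  "FAll i p = FNeg (FEx i (FNeg p))"

definition FExs :: "nat list \<Rightarrow> fm \<Rightarrow> fm" where
  "FExs is p = foldr FEx is p"

definition FAlls :: "nat list \<Rightarrow> fm \<Rightarrow> fm" where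
  "FAlls is p = foldr FAll is p"

text \<open>A number exceeding all (free and bound) variables of the formula.\<close>

primrec var_bound :: "fm \<Rightarrow> nat" where
  "var_bound (FMem i j) = Suc (max i j)"
| "var_bound (FEq i j) = Suc (max i j)"
| "var_bound (FNeg p) = var_bound p"
| "var_bound (FAnd p q) = max (var_bound p) (var_bound q)"
| "var_bound (FEx i p) = max (Suc i) (var_bound p)"

text \<open>Truth in the universe.\<close>

primrec sat :: "('a \<Rightarrow> 'a \<Rightarrow> bool) \<Rightarrow> (nat \<Rightarrow> 'a) \<Rightarrow> fm \<Rightarrow> bool" where
  "sat E \<rho> (FMem i j) \<longleftrightarrow> E (\<rho> i) (\<rho> j)"
| "sat E \<rho> (FEq i j) \<longleftrightarrow> \<rho> i = \<rho> j"
| "sat E \<rho> (FNeg p) \<longleftrightarrow> \<not> sat E \<rho> p"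
| "sat E \<rho> (FAnd p q) \<longleftrightarrow> sat E \<rho> p \<and> sat E \<rho> q"
| "sat E \<rho> (FEx i p) \<longleftrightarrow> (\<exists>x. sat E (\<rho>(i := x)) p)"

text \<open>
  Bounded universal quantification, written \<open>\<not> (\<exists>v\<^sub>i \<in> v\<^sub>j. \<not> p)\<close>, is covered by \<open>neg\<close> and \<open>bex\<close>.
\<close>

inductive bounded_fm :: "fm \<Rightarrow> bool" where
  mem: "bounded_fm (FMem i j)"
| eq: "bounded_fm (FEq i j)"
| neg: "bounded_fm p \<Longrightarrow> bounded_fm (FNeg p)"
| conj: "bounded_fm p \<Longrightarrow> bounded_fm q \<Longrightarrow> bounded_fm (FAnd p q)"
| bex: "bounded_fm p \<Longrightarrow> i \<noteq> j \<Longrightarrow> bounded_fm (FEx i (FAnd (FMem i j) p))"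

fun Sigma_fm :: "nat \<Rightarrow> fm \<Rightarrow> bool" and Pi_fm :: "nat \<Rightarrow> fm \<Rightarrow> bool" where
  "Sigma_fm 0 p \<longleftrightarrow> bounded_fm p"
| "Sigma_fm (Suc n) p \<longleftrightarrow> (\<exists>is q. p = FExs is q \<and> Pi_fm n q)"
| "Pi_fm 0 p \<longleftrightarrow> bounded_fm p"
| "Pi_fm (Suc n) p \<longleftrightarrow> (\<exists>is q. p = FAlls is q \<and> Sigma_fm n q)"

section \<open>The single axioms of ZFC\<close>

definition ax_ext :: fm where
  "ax_ext = FAll 0 (FAll 1 (FImp (FAll 2 (FIff (FMem 2 0) (FMem 2 1))) (FEq 0 1)))"

definition ax_foundation :: fm where
  "ax_foundation = FAll 0 (FImp (FEx 1 (FMem 1 0))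
     (FEx 1 (FAnd (FMem 1 0) (FNeg (FEx 2 (FAnd (FMem 2 1) (FMem 2 0)))))))"

definition ax_pair :: fm where
  "ax_pair = FAll 0 (FAll 1 (FEx 2 (FAll 3 (FIff (FMem 3 2) (FOr (FEq 3 0) (FEq 3 1))))))"

definition ax_union :: fm where
  "ax_union = FAll 0 (FEx 1 (FAll 2 (FIff (FMem 2 1) (FEx 3 (FAnd (FMem 3 0) (FMem 2 3))))))"

definition ax_power :: fm where
  "ax_power = FAll 0 (FEx 1 (FAll 2 (FIff (FMem 2 1) (FAll 3 (FImp (FMem 3 2) (FMem 3 0))))))"

definition ax_infinity :: fm where
  "ax_infinity = FEx 0 (FAnd
     (FEx 1 (FAnd (FMem 1 0) (FAll 2 (FNeg (FMem 2 1)))))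
     (FAll 1 (FImp (FMem 1 0)
        (FEx 2 (FAnd (FMem 2 0) (FAll 3 (FIff (FMem 3 2) (FOr (FMem 3 1) (FEq 3 1)))))))))"

text \<open>Every set of nonempty pairwise disjoint sets has a choice set.\<close>

definition ax_choice :: fm where
  "ax_choice = FAll 0 (FImp
     (FAnd
       (FAll 1 (FImp (FMem 1 0) (FEx 2 (FMem 2 1))))
       (FAll 1 (FAll 2 (FImp (FAnd (FMem 1 0) (FAnd (FMem 2 0) (FNeg (FEq 1 2))))
          (FNeg (FEx 3 (FAnd (FMem 3 1) (FMem 3 2))))))))
     (FEx 4 (FAll 1 (FImp (FMem 1 0)
        (FEx 2 (FAll 3 (FIff (FAnd (FMem 3 1) (FMem 3 4)) (FEq 3 2))))))))"

definition ZFC_single :: "fm set" where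
  "ZFC_single = {ax_ext, ax_foundation, ax_pair, ax_union, ax_power, ax_infinity, ax_choice}"

section \<open>Set theory inside a structure\<close>

context
  fixes E :: "'a \<Rightarrow> 'a \<Rightarrow> bool"  (infix "\<^bold>\<in>" 50)
begin

subsection \<open>Basic notions\<close>

text \<open>
  The definite descriptions below are well-defined in structures satisfying \<open>BST\<close>.
\<close>

definition vempty :: 'a where
  "vempty = (THE z. \<forall>u. \<not> u \<^bold>\<in> z)"

definition vpair :: "'a \<Rightarrow> 'a \<Rightarrow> 'a" where
  "vpair x y = (THE z. \<forall>u. u \<^bold>\<in> z \<longleftrightarrow> u = x \<or> u = y)"

definition opair :: "'a \<Rightarrow> 'a \<Rightarrow> 'a" where
  "opair x y = vpair (vpair x x) (vpair x y)"

text \<open>\<open>vinsert x a\<close> is \<open>{x} \<union> a\<close>.\<close>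

definition vinsert :: "'a \<Rightarrow> 'a \<Rightarrow> 'a" where
  "vinsert x a = (THE z. \<forall>u. u \<^bold>\<in> z \<longleftrightarrow> u = x \<or> u \<^bold>\<in> a)"

definition vsucc :: "'a \<Rightarrow> 'a" where
  "vsucc x = vinsert x x"

definition vsubset :: "'a \<Rightarrow> 'a \<Rightarrow> bool" where
  "vsubset x y \<longleftrightarrow> (\<forall>u. u \<^bold>\<in> x \<longrightarrow> u \<^bold>\<in> y)"

definition inductive_set_in :: "'a \<Rightarrow> bool" where
  "inductive_set_in w \<longleftrightarrow> vempty \<^bold>\<in> w \<and> (\<forall>x. x \<^bold>\<in> w \<longrightarrow> vsucc x \<^bold>\<in> w)"

definition is_omega :: "'a \<Rightarrow> bool" where
  "is_omega w \<longleftrightarrow> inductive_set_in w \<and> (\<forall>v. inductive_set_in v \<longrightarrow> vsubset w v)"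

definition omega :: 'a where
  "omega = (THE w. is_omega w)"

text \<open>\<open>s\<close> is a function with domain \<open>d\<close> and values in \<open>m\<close>.\<close>

definition fun_into :: "'a \<Rightarrow> 'a \<Rightarrow> 'a \<Rightarrow> bool" where
  "fun_into d m s \<longleftrightarrow>
     (\<forall>z. z \<^bold>\<in> s \<longrightarrow> (\<exists>i x. i \<^bold>\<in> d \<and> x \<^bold>\<in> m \<and> z = opair i x)) \<and>
     (\<forall>i. i \<^bold>\<in> d \<longrightarrow> (\<exists>!x. opair i x \<^bold>\<in> s))"

definition fun_on :: "'a \<Rightarrow> 'a \<Rightarrow> bool" where
  "fun_on d s \<longleftrightarrow> (\<exists>m. fun_into d m s)"

definition vapp :: "'a \<Rightarrow> 'a \<Rightarrow> 'a" where
  "vapp s i = (THE x. opair i x \<^bold>\<in> s)"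

primrec num :: "nat \<Rightarrow> 'a" where
  "num 0 = vempty"
| "num (Suc n) = vsucc (num n)"

subsection \<open>The theory BST\<close>

definition BST :: bool where
  "BST \<longleftrightarrow>
     (\<exists>x. \<forall>y. \<not> y \<^bold>\<in> x) \<and>
     (\<forall>x y. (\<forall>u. u \<^bold>\<in> x \<longleftrightarrow> u \<^bold>\<in> y) \<longrightarrow> x = y) \<and>
     (\<forall>x y. \<exists>z. \<forall>u. u \<^bold>\<in> z \<longleftrightarrow> u = x \<or> u = y) \<and>
     (\<forall>x. \<exists>z. \<forall>u. u \<^bold>\<in> z \<longleftrightarrow> (\<exists>y. y \<^bold>\<in> x \<and> u \<^bold>\<in> y)) \<and>
     (\<forall>x y. \<exists>z. \<forall>u. u \<^bold>\<in> z \<longleftrightarrow> (\<exists>a b. a \<^bold>\<in> x \<and> b \<^bold>\<in> y \<and> u = opair a b)) \<and>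
     (\<exists>w. is_omega w) \<and>
     (\<forall>\<phi> \<rho> i x. bounded_fm \<phi> \<longrightarrow>
        (\<exists>z. \<forall>u. u \<^bold>\<in> z \<longleftrightarrow> u \<^bold>\<in> x \<and> sat E (\<rho>(i := u)) \<phi>))"

subsection \<open>Codes of formulas\<close>

text \<open>The variables of codes are the elements of \<open>omega\<close>.\<close>

definition cMem :: "'a \<Rightarrow> 'a \<Rightarrow> 'a" where
  "cMem i j = opair (num 0) (opair i j)"

definition cEq :: "'a \<Rightarrow> 'a \<Rightarrow> 'a" where
  "cEq i j = opair (num 1) (opair i j)"

definition cNeg :: "'a \<Rightarrow> 'a" where
  "cNeg p = opair (num 2) p"

definition cAnd :: "'a \<Rightarrow> 'a \<Rightarrow> 'a" where
  "cAnd p q = opair (num 3) (opair p q)"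

definition cEx :: "'a \<Rightarrow> 'a \<Rightarrow> 'a" where
  "cEx i p = opair (num 4) (opair i p)"

definition cImp :: "'a \<Rightarrow> 'a \<Rightarrow> 'a" where
  "cImp p q = cNeg (cAnd p (cNeg q))"

definition cIff :: "'a \<Rightarrow> 'a \<Rightarrow> 'a" where
  "cIff p q = cAnd (cImp p q) (cImp q p)"

definition cAll :: "'a \<Rightarrow> 'a \<Rightarrow> 'a" where
  "cAll i p = cNeg (cEx i (cNeg p))"

primrec quote :: "fm \<Rightarrow> 'a" where
  "quote (FMem i j) = cMem (num i) (num j)"
| "quote (FEq i j) = cEq (num i) (num j)"
| "quote (FNeg p) = cNeg (quote p)"
| "quote (FAnd p q) = cAnd (quote p) (quote q)"
| "quote (FEx i p) = cEx (num i) (quote p)"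

text \<open>
  \<open>p\<close> is a formula all of whose variables, free or bound, are in \<open>w\<close>: it is the last
  entry of a formation sequence \<open>f\<close> of length \<open>l + 1\<close>.
\<close>

definition formula_over :: "'a \<Rightarrow> 'a \<Rightarrow> bool" where
  "formula_over w p \<longleftrightarrow>
     (\<exists>l f. l \<^bold>\<in> omega \<and> fun_on (vsucc l) f \<and> vapp f l = p \<and>
        (\<forall>k. k \<^bold>\<in> vsucc l \<longrightarrow>
           (\<exists>i j. i \<^bold>\<in> w \<and> j \<^bold>\<in> w \<and> vapp f k = cMem i j) \<or>
           (\<exists>i j. i \<^bold>\<in> w \<and> j \<^bold>\<in> w \<and> vapp f k = cEq i j) \<or>
           (\<exists>a. a \<^bold>\<in> k \<and> vapp f k = cNeg (vapp f a)) \<or>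
           (\<exists>a b. a \<^bold>\<in> k \<and> b \<^bold>\<in> k \<and> vapp f k = cAnd (vapp f a) (vapp f b)) \<or>
           (\<exists>i a. i \<^bold>\<in> w \<and> a \<^bold>\<in> k \<and> vapp f k = cEx i (vapp f a))))"

text \<open>\<open>p\<close> is a formula in which the variable \<open>v\<close> does not occur.\<close>

definition formula_without :: "'a \<Rightarrow> 'a \<Rightarrow> bool" where
  "formula_without v p \<longleftrightarrow> (\<exists>w. vsubset w omega \<and> \<not> v \<^bold>\<in> w \<and> formula_over w p)"

subsection \<open>Satisfaction in a set\<close>

text \<open>
  An assignment is a function \<open>s\<close> from a natural number \<open>n\<close> to \<open>M\<close>, used for formulas
  with variables below \<open>n\<close>.  (The functions from \<open>omega\<close> to \<open>M\<close> need not form a set,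
  as the power set axiom is not available.)  \<open>T\<close> is a satisfaction relation for the formulas
  in \<open>F\<close>, a set closed under immediate subformulas.
\<close>

definition sat_rel :: "'a \<Rightarrow> 'a \<Rightarrow> 'a \<Rightarrow> 'a \<Rightarrow> bool" where
  "sat_rel M n F T \<longleftrightarrow>
     (\<forall>i j. i \<^bold>\<in> n \<and> j \<^bold>\<in> n \<and> cMem i j \<^bold>\<in> F \<longrightarrow>
        (\<forall>s. fun_into n M s \<longrightarrow> (opair (cMem i j) s \<^bold>\<in> T \<longleftrightarrow> vapp s i \<^bold>\<in> vapp s j))) \<and>
     (\<forall>i j. i \<^bold>\<in> n \<and> j \<^bold>\<in> n \<and> cEq i j \<^bold>\<in> F \<longrightarrow>
        (\<forall>s. fun_into n M s \<longrightarrow> (opair (cEq i j) s \<^bold>\<in> T \<longleftrightarrow> vapp s i = vapp s j))) \<and>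
     (\<forall>p. cNeg p \<^bold>\<in> F \<longrightarrow> p \<^bold>\<in> F \<and>
        (\<forall>s. fun_into n M s \<longrightarrow> (opair (cNeg p) s \<^bold>\<in> T \<longleftrightarrow> \<not> opair p s \<^bold>\<in> T))) \<and>
     (\<forall>p q. cAnd p q \<^bold>\<in> F \<longrightarrow> p \<^bold>\<in> F \<and> q \<^bold>\<in> F \<and>
        (\<forall>s. fun_into n M s \<longrightarrow>
           (opair (cAnd p q) s \<^bold>\<in> T \<longleftrightarrow> opair p s \<^bold>\<in> T \<and> opair q s \<^bold>\<in> T))) \<and>
     (\<forall>i p. i \<^bold>\<in> n \<and> cEx i p \<^bold>\<in> F \<longrightarrow> p \<^bold>\<in> F \<and>
        (\<forall>s. fun_into n M s \<longrightarrow>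
           (opair (cEx i p) s \<^bold>\<in> T \<longleftrightarrow>
              (\<exists>t. fun_into n M t \<and> (\<forall>j. j \<^bold>\<in> n \<and> j \<noteq> i \<longrightarrow> vapp t j = vapp s j) \<and>
                 opair p t \<^bold>\<in> T))))"

definition sat_in :: "'a \<Rightarrow> 'a \<Rightarrow> 'a \<Rightarrow> 'a \<Rightarrow> bool" where
  "sat_in M n p s \<longleftrightarrow> (\<exists>F T. sat_rel M n F T \<and> p \<^bold>\<in> F \<and> opair p s \<^bold>\<in> T)"

text \<open>Satisfaction of the universal closure of \<open>p\<close>.\<close>

definition sat_closure :: "'a \<Rightarrow> 'a \<Rightarrow> bool" where
  "sat_closure M p \<longleftrightarrow>
     (\<forall>n s. n \<^bold>\<in> omega \<and> formula_over n p \<and> fun_into n M s \<longrightarrow> sat_in M n p s)"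

text \<open>The internal finite sequence \<open>\<langle>\<rho> 0, \<dots>, \<rho> (m - 1)\<rangle>\<close>.\<close>

primrec tuple :: "(nat \<Rightarrow> 'a) \<Rightarrow> nat \<Rightarrow> 'a" where
  "tuple \<rho> 0 = vempty"
| "tuple \<rho> (Suc m) = vinsert (opair (num m) (\<rho> m)) (tuple \<rho> m)"

definition sat_in_fm :: "'a \<Rightarrow> (nat \<Rightarrow> 'a) \<Rightarrow> fm \<Rightarrow> bool" where
  "sat_in_fm M \<rho> \<phi> \<longleftrightarrow> sat_in M (num (var_bound \<phi>)) (quote \<phi>) (tuple \<rho> (var_bound \<phi>))"

subsection \<open>Transitive models of ZFC\<close>

text \<open>\<open>\<forall>a \<exists>b \<forall>x (x \<in> b \<longleftrightarrow> x \<in> a \<and> p)\<close>, where \<open>b\<close> does not occur in \<open>p\<close>.\<close>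

definition separation_instance :: "'a \<Rightarrow> bool" where
  "separation_instance r \<longleftrightarrow>
     (\<exists>p x a b. x \<^bold>\<in> omega \<and> a \<^bold>\<in> omega \<and> b \<^bold>\<in> omega \<and> distinct [x, a, b] \<and>
        formula_without b p \<and>
        r = cAll a (cEx b (cAll x (cIff (cMem x b) (cAnd (cMem x a) p)))))"

text \<open>
  \<open>\<forall>a (\<forall>x \<in> a \<exists>!y p \<longrightarrow> \<exists>b \<forall>x \<in> a \<exists>y \<in> b p)\<close>, where \<open>b\<close> does not occur in \<open>p\<close>; here
  \<open>\<exists>!y p\<close> is \<open>\<exists>z \<forall>y (p \<longleftrightarrow> y = z)\<close> with \<open>z\<close> not occurring in \<open>p\<close>.
\<close>

definition replacement_instance :: "'a \<Rightarrow> bool" where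
  "replacement_instance r \<longleftrightarrow>
     (\<exists>p x y z a b. x \<^bold>\<in> omega \<and> y \<^bold>\<in> omega \<and> z \<^bold>\<in> omega \<and> a \<^bold>\<in> omega \<and> b \<^bold>\<in> omega \<and>
        distinct [x, y, z, a, b] \<and> formula_without z p \<and> formula_without b p \<and>
        r = cAll a (cImp
              (cAll x (cImp (cMem x a) (cEx z (cAll y (cIff p (cEq y z))))))
              (cEx b (cAll x (cImp (cMem x a) (cEx y (cAnd (cMem y b) p)))))))"

definition ZFC_axiom :: "'a \<Rightarrow> bool" where
  "ZFC_axiom p \<longleftrightarrow> p \<in> quote ` ZFC_single \<or> separation_instance p \<or> replacement_instance p"

text \<open>
  \<open>M\<close> has to be required nonempty because \<open>sat_closure\<close> holds vacuously in the empty set.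
\<close>

definition is_model :: "'a \<Rightarrow> bool" where
  "is_model M \<longleftrightarrow>
     (\<exists>x. x \<^bold>\<in> M) \<and>
     (\<forall>x. x \<^bold>\<in> M \<longrightarrow> vsubset x M) \<and>
     (\<forall>p. ZFC_axiom p \<longrightarrow> sat_closure M p)"

definition elem_submodel :: "'a \<Rightarrow> 'a \<Rightarrow> bool" where
  "elem_submodel M N \<longleftrightarrow> vsubset M N \<and>
     (\<forall>n p s. n \<^bold>\<in> omega \<and> formula_over n p \<and> fun_into n M s \<longrightarrow>
        (sat_in M n p s \<longleftrightarrow> sat_in N n p s))"

definition strongly_extendible :: "'a \<Rightarrow> bool" where
  "strongly_extendible M \<longleftrightarrow>
     is_model M \<and> (\<forall>x. \<exists>N. is_model N \<and> x \<^bold>\<in> N \<and> elem_submodel M N)"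

subsection \<open>The theories LZFC and LZFC-sext\<close>

definition Loc_ZFC :: bool where
  "Loc_ZFC \<longleftrightarrow> (\<forall>x. \<exists>M. is_model M \<and> x \<^bold>\<in> M)"

definition LZFC :: bool where
  "LZFC \<longleftrightarrow> BST \<and> Loc_ZFC"

definition Loc_sext_ZFC :: bool where
  "Loc_sext_ZFC \<longleftrightarrow> (\<forall>x. \<exists>M. strongly_extendible M \<and> x \<^bold>\<in> M)"

definition LZFC_sext :: bool where
  "LZFC_sext \<longleftrightarrow> LZFC \<and> Loc_sext_ZFC"

subsection \<open>Elementarity in the universe\<close>

text \<open>
  The parameters from \<open>M\<close> are the values of \<open>\<rho>\<close>.  As truth in \<open>V\<close> is not definable,
  \<open>\<phi>\<close> is a metatheoretic formula.
\<close>

definition Sigma_elem_V :: "nat \<Rightarrow> 'a \<Rightarrow> bool" where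
  "Sigma_elem_V n M \<longleftrightarrow>
     (\<forall>\<phi> \<rho>. Sigma_fm n \<phi> \<and> (\<forall>i. \<rho> i \<^bold>\<in> M) \<longrightarrow> (sat_in_fm M \<rho> \<phi> \<longleftrightarrow> sat E \<rho> \<phi>))"

end

end

theory Submission
  imports Defs
begin

text \<open>
  For metatheoretic formulas, satisfaction in a model \<open>M\<close> as defined inside the theory coincides
  with truth relativised to \<open>M\<close>: a model contains all tuples of its elements of standard length,
  hence bounded separation from \<open>M\<close> yields a satisfaction relation for the finitely many
  subformulas of a given formula.  Elementarity of \<open>M\<close> in \<open>N\<close> therefore transfers relativised truth.

  Bounded formulas are absolute for transitive sets.  If a \<open>\<Sigma>\<^sub>1\<close> or \<open>\<Sigma>\<^sub>2\<close> formula holds in the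
  universe, choose \<open>N\<close> containing witnesses for its leading existential quantifiers; the
  remaining \<open>\<Pi>\<^sub>0\<close> or \<open>\<Pi>\<^sub>1\<close> formula is inherited by \<open>N\<close>, and elementarity brings the whole formula
  down to \<open>M\<close>.  Conversely, \<open>\<Sigma>\<^sub>1\<close> truth goes up from \<open>M\<close> by transitivity, and \<open>\<Sigma>\<^sub>2\<close> truth goes up
  because \<open>\<Pi>\<^sub>1\<close> truth does, by what has been shown about \<open>\<Sigma>\<^sub>1\<close> formulas.
\<close>

section \<open>Relativised truth\<close>

text \<open>The domain is an external set, so truth in a set of the structure
  (\<open>A = elems M\<close>) and truth in the universe (\<open>A = UNIV\<close>) become instances
  of one notion and share the lemmas on quantifier blocks.\<close>

primrec sat_on :: "('a \<Rightarrow> 'a \<Rightarrow> bool) \<Rightarrow> 'a set \<Rightarrow> (nat \<Rightarrow> 'a) \<Rightarrow> fm \<Rightarrow> bool" where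
  "sat_on E A \<rho> (FMem i j) \<longleftrightarrow> E (\<rho> i) (\<rho> j)"
| "sat_on E A \<rho> (FEq i j) \<longleftrightarrow> \<rho> i = \<rho> j"
| "sat_on E A \<rho> (FNeg p) \<longleftrightarrow> \<not> sat_on E A \<rho> p"
| "sat_on E A \<rho> (FAnd p q) \<longleftrightarrow> sat_on E A \<rho> p \<and> sat_on E A \<rho> q"
| "sat_on E A \<rho> (FEx i p) \<longleftrightarrow> (\<exists>x\<in>A. sat_on E A (\<rho>(i := x)) p)"

lemma sat_on_UNIV: "sat_on E UNIV \<rho> p \<longleftrightarrow> sat E \<rho> p"
  by (induction p arbitrary: \<rho>) auto

lemma sat_on_cong:
  "(\<And>i. i < var_bound p \<Longrightarrow> \<rho> i = \<sigma> i) \<Longrightarrow> sat_on E A \<rho> p \<longleftrightarrow> sat_on E A \<sigma> p"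
proof (induction p arbitrary: \<rho> \<sigma>)
  case (FEx i p)
  have "sat_on E A (\<rho>(i := x)) p \<longleftrightarrow> sat_on E A (\<sigma>(i := x)) p" for x
    by (rule FEx.IH) (use FEx.prems in auto)
  then show ?case by simp
next
  case (FNeg p)
  show ?case using FNeg.IH[of \<rho> \<sigma>] FNeg.prems by simp
next
  case (FAnd p q)
  show ?case using FAnd.IH(1)[of \<rho> \<sigma>] FAnd.IH(2)[of \<rho> \<sigma>] FAnd.prems by simp
qed auto

section \<open>Derived connectives and quantifier blocks\<close>

lemma sat_on_FOr [simp]: "sat_on E A \<rho> (FOr p q) \<longleftrightarrow> sat_on E A \<rho> p \<or> sat_on E A \<rho> q"
  by (simp add: FOr_def)

lemma sat_on_FImp [simp]: "sat_on E A \<rho> (FImp p q) \<longleftrightarrow> (sat_on E A \<rho> p \<longrightarrow> sat_on E A \<rho> q)"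
  by (simp add: FImp_def)

lemma sat_on_FIff [simp]: "sat_on E A \<rho> (FIff p q) \<longleftrightarrow> (sat_on E A \<rho> p \<longleftrightarrow> sat_on E A \<rho> q)"
  by (auto simp: FIff_def)

lemma sat_on_FAll [simp]: "sat_on E A \<rho> (FAll i p) \<longleftrightarrow> (\<forall>x\<in>A. sat_on E A (\<rho>(i := x)) p)"
  by (simp add: FAll_def)

text \<open>Only the final value of each variable matters, so a block amounts to one choice of a
  modified assignment; repeated variables in the block do no harm.\<close>

lemma sat_on_FExs:
  "sat_on E A \<rho> (FExs is p) \<longleftrightarrow>
    (\<exists>\<sigma>. (\<forall>i. i \<notin> set is \<longrightarrow> \<sigma> i = \<rho> i) \<and> (\<forall>i\<in>set is. \<sigma> i \<in> A) \<and> sat_on E A \<sigma> p)"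
proof (induction "is" arbitrary: \<rho>)
  case Nil
  have "\<sigma> = \<rho>" if "\<forall>i. \<sigma> i = \<rho> i" for \<sigma>
    using that by auto
  then show ?case by (auto simp: FExs_def)
next
  case (Cons j js)
  have "sat_on E A \<rho> (FExs (j # js) p) \<longleftrightarrow> (\<exists>x\<in>A. sat_on E A (\<rho>(j := x)) (FExs js p))"
    by (simp add: FExs_def)
  also have "\<dots> \<longleftrightarrow> (\<exists>x\<in>A. \<exists>\<sigma>. (\<forall>i. i \<notin> set js \<longrightarrow> \<sigma> i = (\<rho>(j := x)) i) \<and>
      (\<forall>i\<in>set js. \<sigma> i \<in> A) \<and> sat_on E A \<sigma> p)"
    by (simp only: Cons.IH)
  also have "\<dots> \<longleftrightarrow> (\<exists>\<sigma>. (\<forall>i. i \<notin> set (j # js) \<longrightarrow> \<sigma> i = \<rho> i) \<and>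
      (\<forall>i\<in>set (j # js). \<sigma> i \<in> A) \<and> sat_on E A \<sigma> p)" (is "?L \<longleftrightarrow> ?R")
  proof
    assume ?L
    then obtain x \<sigma> where "x \<in> A" "\<forall>i. i \<notin> set js \<longrightarrow> \<sigma> i = (\<rho>(j := x)) i"
      "\<forall>i\<in>set js. \<sigma> i \<in> A" "sat_on E A \<sigma> p" by blast
    \<comment> \<open>If \<open>j\<close> recurs in \<open>js\<close>, its final value comes from
      the inner block; otherwise it is \<open>x\<close>.\<close>
    moreover from this have "\<sigma> j \<in> A" by (cases "j \<in> set js") auto
    ultimately show ?R
      by (intro exI[of _ \<sigma>]) auto
  next
    assume ?R
    then obtain \<sigma> where s: "\<forall>i. i \<notin> set (j # js) \<longrightarrow> \<sigma> i = \<rho> i"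
      "\<forall>i\<in>set (j # js). \<sigma> i \<in> A" "sat_on E A \<sigma> p" by blast
    \<comment> \<open>The final value of \<open>j\<close> is a witness even if \<open>j\<close>
      recurs in \<open>js\<close>, because the inner block then overwrites it.\<close>
    show ?L
      by (rule bexI[of _ "\<sigma> j"], rule exI[of _ \<sigma>]) (use s in auto)
  qed
  finally show ?case .
qed

lemma sat_on_FAlls: "sat_on E A \<rho> (FAlls is p) \<longleftrightarrow> \<not> sat_on E A \<rho> (FExs is (FNeg p))"
  by (induction "is" arbitrary: \<rho>) (simp_all add: FAlls_def FExs_def)

text \<open>A witness of a bounded quantifier is an element of some \<open>\<rho> j\<close> in
  \<open>A\<close>, hence in \<open>A\<close> by transitivity. The condition
  \<open>i \<noteq> j\<close> ensures that the update leaves the bound alone.\<close>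

lemma bounded_fm_absolute:
  assumes "bounded_fm p" and "\<And>x y. y \<in> A \<Longrightarrow> E x y \<Longrightarrow> x \<in> A" and "\<And>i. \<rho> i \<in> A"
  shows "sat_on E A \<rho> p \<longleftrightarrow> sat E \<rho> p"
  using assms(1,3)
proof (induction arbitrary: \<rho>)
  case (bex p i j)
  have "sat_on E A (\<rho>(i := x)) p \<longleftrightarrow> sat E (\<rho>(i := x)) p" if "x \<in> A" for x
    by (rule bex.IH) (use bex.prems that in auto)
  then show ?case
    using assms(2)[OF bex.prems[of j]] bex.hyps by auto
qed auto

lemma Sigma_fm_1: "Sigma_fm 1 p \<longleftrightarrow> (\<exists>is q. p = FExs is q \<and> bounded_fm q)"
  by (simp add: One_nat_def)

lemma Sigma_fm_2: "Sigma_fm 2 p \<longleftrightarrow> (\<exists>is js q. p = FExs is (FAlls js q) \<and> bounded_fm q)"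
  by (auto simp: numeral_2_eq_2)

text \<open>Truth of \<open>p\<close> relativised to the set denoted by the variable \<open>m\<close>.\<close>

primrec relativize :: "nat \<Rightarrow> fm \<Rightarrow> fm" where
  "relativize m (FMem i j) = FMem i j"
| "relativize m (FEq i j) = FEq i j"
| "relativize m (FNeg p) = FNeg (relativize m p)"
| "relativize m (FAnd p q) = FAnd (relativize m p) (relativize m q)"
| "relativize m (FEx i p) = FEx i (FAnd (FMem i m) (relativize m p))"

text \<open>As \<open>m\<close> exceeds every variable of \<open>p\<close>, each guard
  \<open>FMem i m\<close> has \<open>i \<noteq> m\<close>. For the same reason the value of
  \<open>m\<close> stays fixed in \<open>sat_relativize\<close>.\<close>

lemma bounded_fm_relativize: "var_bound p \<le> m \<Longrightarrow> bounded_fm (relativize m p)"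
  by (induction p) (auto intro: bounded_fm.intros)

lemma sat_relativize:
  "var_bound p \<le> m \<Longrightarrow> sat E \<rho> (relativize m p) \<longleftrightarrow> sat_on E {x. E x (\<rho> m)} \<rho> p"
  by (induction p arbitrary: \<rho>) auto

section \<open>Subformulas and formation sequences\<close>

text \<open>The order puts every formula after its components, so that the list, repetitions
  included, can serve as a formation sequence.\<close>

primrec subfms :: "fm \<Rightarrow> fm list" where
  "subfms (FMem i j) = [FMem i j]"
| "subfms (FEq i j) = [FEq i j]"
| "subfms (FNeg p) = subfms p @ [FNeg p]"
| "subfms (FAnd p q) = subfms p @ subfms q @ [FAnd p q]"
| "subfms (FEx i p) = subfms p @ [FEx i p]"

lemma subfms_snoc: "\<exists>L. subfms p = L @ [p]"
  by (cases p) auto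

lemma self_in_subfms: "p \<in> set (subfms p)"
  by (cases p) auto

lemma subfms_trans: "q \<in> set (subfms p) \<Longrightarrow> r \<in> set (subfms q) \<Longrightarrow> r \<in> set (subfms p)"
  by (induction p) auto

lemma var_bound_subfms: "q \<in> set (subfms p) \<Longrightarrow> var_bound q \<le> var_bound p"
  by (induction p) auto

text \<open>This mirrors the clauses of \<open>formula_over\<close>: \<open>A\<close> stands for the
  earlier entries of the sequence, and \<open>k\<close> bounds the variables.\<close>

primrec built_from :: "nat \<Rightarrow> fm set \<Rightarrow> fm \<Rightarrow> bool" where
  "built_from k A (FMem i j) \<longleftrightarrow> i < k \<and> j < k"
| "built_from k A (FEq i j) \<longleftrightarrow> i < k \<and> j < k"
| "built_from k A (FNeg p) \<longleftrightarrow> p \<in> A"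
| "built_from k A (FAnd p q) \<longleftrightarrow> p \<in> A \<and> q \<in> A"
| "built_from k A (FEx i p) \<longleftrightarrow> i < k \<and> p \<in> A"

lemma built_from_mono: "built_from k A p \<Longrightarrow> A \<subseteq> B \<Longrightarrow> built_from k B p"
  by (cases p) auto

definition formation :: "nat \<Rightarrow> fm list \<Rightarrow> bool" where
  "formation k L \<longleftrightarrow> (\<forall>m<length L. built_from k (set (take m L)) (L ! m))"

lemma formation_append:
  assumes "formation k L" and "formation k L'"
  shows "formation k (L @ L')"
  unfolding formation_def
proof (intro allI impI)
  fix m assume m: "m < length (L @ L')"
  show "built_from k (set (take m (L @ L'))) ((L @ L') ! m)"
  proof (cases "m < length L")
    case True
    then show ?thesis using assms(1) by (simp add: formation_def nth_append)
  next
    case False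
    then have "built_from k (set (take (m - length L) L')) (L' ! (m - length L))"
      using assms(2) m by (simp add: formation_def)
    then show ?thesis using False by (auto simp: nth_append elim: built_from_mono)
  qed
qed

lemma formation_snoc:
  assumes "formation k L" and "built_from k (set L) p"
  shows "formation k (L @ [p])"
  using assms by (auto simp: formation_def nth_append less_Suc_eq)

lemma formation_subfms: "var_bound p \<le> k \<Longrightarrow> formation k (subfms p)"
proof (induction p)
  case (FAnd p q)
  then have "formation k ((subfms p @ subfms q) @ [FAnd p q])"
    by (intro formation_snoc formation_append) (auto simp: self_in_subfms)
  then show ?case by simp
qed (auto simp: formation_def[of _ "[_]"] self_in_subfms intro!: formation_snoc)

section \<open>Set theory in BST\<close>

context
  fixes E :: "'a \<Rightarrow> 'a \<Rightarrow> bool"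
  assumes BST: "BST E"
begin

lemma extensionality: "(\<And>u. E u x \<longleftrightarrow> E u y) \<Longrightarrow> x = y"
  using BST by (simp add: BST_def)

lemma separation:
  "bounded_fm \<phi> \<Longrightarrow> \<exists>z. \<forall>u. E u z \<longleftrightarrow> E u x \<and> sat E (\<rho>(i := u)) \<phi>"
  using BST by (simp add: BST_def)

text \<open>Extensionality gives uniqueness, so each description used for \<open>vempty\<close>,
  \<open>vpair\<close> and \<open>vinsert\<close> only needs existence.\<close>

lemma the_set: "\<exists>z. \<forall>u. E u z \<longleftrightarrow> P u \<Longrightarrow> E u (THE z. \<forall>u. E u z \<longleftrightarrow> P u) \<longleftrightarrow> P u"
proof -
  assume "\<exists>z. \<forall>u. E u z \<longleftrightarrow> P u"
  then obtain z where z: "\<forall>u. E u z \<longleftrightarrow> P u" by blast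
  have "(THE z. \<forall>u. E u z \<longleftrightarrow> P u) = z"
    by (rule the_equality) (use z in \<open>auto intro: extensionality\<close>)
  then show ?thesis using z by simp
qed

lemma not_mem_vempty [simp]: "\<not> E u (vempty E)"
  using the_set[of "\<lambda>_. False" u] BST by (simp add: vempty_def BST_def)

lemma mem_vpair [simp]: "E u (vpair E x y) \<longleftrightarrow> u = x \<or> u = y"
  unfolding vpair_def by (rule the_set) (use BST in \<open>simp add: BST_def\<close>)

lemma union_exists: "\<exists>z. \<forall>u. E u z \<longleftrightarrow> (\<exists>y. E y x \<and> E u y)"
  using BST by (simp add: BST_def)

lemma binary_union_exists: "\<exists>z. \<forall>u. E u z \<longleftrightarrow> E u x \<or> E u y"
  using union_exists[of "vpair E x y"] by auto

lemma mem_vinsert [simp]: "E u (vinsert E x a) \<longleftrightarrow> u = x \<or> E u a"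
  unfolding vinsert_def
  by (rule the_set) (use binary_union_exists[of "vpair E x x" a] in simp)

lemma mem_vsucc [simp]: "E u (vsucc E x) \<longleftrightarrow> u = x \<or> E u x"
  by (simp add: vsucc_def)

lemma vpair_eq_iff: "vpair E a b = vpair E c d \<longleftrightarrow> a = c \<and> b = d \<or> a = d \<and> b = c"
  by (metis extensionality mem_vpair)

lemma opair_eq_iff [simp]: "opair E a b = opair E c d \<longleftrightarrow> a = c \<and> b = d"
  by (auto simp: opair_def vpair_eq_iff)

lemma product_exists:
  "\<exists>z. \<forall>u. E u z \<longleftrightarrow> (\<exists>a b. E a x \<and> E b y \<and> u = opair E a b)"
  using BST by (simp add: BST_def)

text \<open>The list is external, so iterating \<open>vinsert\<close> along it suffices.\<close>

lemma finite_set_exists: "\<exists>z. \<forall>u. E u z \<longleftrightarrow> u \<in> set xs"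
proof (induction xs)
  case Nil
  show ?case by (rule exI[of _ "vempty E"]) simp
next
  case (Cons x xs)
  then obtain z where "\<forall>u. E u z \<longleftrightarrow> u \<in> set xs" by blast
  then show ?case by (intro exI[of _ "vinsert E x z"]) simp
qed

section \<open>Numerals and internal tuples\<close>

lemma is_omega_omega: "is_omega E (omega E)"
proof -
  obtain w where w: "is_omega E w" using BST by (auto simp: BST_def)
  show ?thesis
    unfolding omega_def
  proof (rule theI[where P = "is_omega E", OF w])
    fix v assume "is_omega E v"
    then have "vsubset E v w" "vsubset E w v" using w by (simp_all add: is_omega_def)
    then show "v = w" by (intro extensionality) (auto simp: vsubset_def)
  qed
qed

lemma num_in_omega: "E (num E n) (omega E)"
proof -
  have "inductive_set_in E (omega E)" using is_omega_omega by (simp add: is_omega_def)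
  then show ?thesis by (induction n) (simp_all add: inductive_set_in_def)
qed

text \<open>Induction on the external \<open>n\<close> works although \<open>omega E\<close> may
  have nonstandard elements. This is what ties internal functions on \<open>num E k\<close> to
  external finite sequences.\<close>

lemma mem_num: "E u (num E n) \<longleftrightarrow> (\<exists>m<n. u = num E m)"
  by (induction n) (auto simp: less_Suc_eq)

lemma num_transitive: "E u (num E n) \<Longrightarrow> E v u \<Longrightarrow> E v (num E n)"
proof -
  assume "E u (num E n)" and v: "E v u"
  then obtain m where "m < n" "u = num E m" unfolding mem_num by blast
  moreover from this v obtain l where "l < m" "v = num E l" by (auto simp: mem_num)
  ultimately have "l < n \<and> v = num E l" by simp
  then show ?thesis unfolding mem_num by blast
qed

text \<open>BST has no foundation axiom, so induction is used: if the successor of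
  \<open>num E n\<close> belonged to itself, it would equal or belong to \<open>num E n\<close>, and
  either way \<open>num E n\<close> would be a member of itself.\<close>

lemma num_irrefl: "\<not> E (num E n) (num E n)"
proof (induction n)
  case (Suc n)
  have n: "E (num E n) (num E (Suc n))" by simp
  show ?case
  proof
    assume "E (num E (Suc n)) (num E (Suc n))"
    then consider "num E (Suc n) = num E n" | "E (num E (Suc n)) (num E n)"
      by (auto simp only: num.simps mem_vsucc)
    then show False
    proof cases
      case 1
      then show False using n Suc by (simp only: simp_thms)
    next
      case 2
      from num_transitive[OF this n] Suc show False by contradiction
    qed
  qed
qed simp

lemma num_mem_num: "m < n \<Longrightarrow> E (num E m) (num E n)"
  unfolding mem_num by blast

lemma num_eq_iff [simp]: "num E m = num E n \<longleftrightarrow> m = n"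
proof (cases m n rule: linorder_cases)
  case less
  then show ?thesis using num_mem_num[OF less] num_irrefl[of n] by (metis less_irrefl)
next
  case greater
  then show ?thesis using num_mem_num[OF greater] num_irrefl[of m] by (metis less_irrefl)
qed simp

lemma mem_num_num: "E (num E m) (num E n) \<longleftrightarrow> m < n"
  by (simp add: mem_num)

lemma mem_tuple: "E z (tuple E \<rho> k) \<longleftrightarrow> (\<exists>i<k. z = opair E (num E i) (\<rho> i))"
  by (induction k) (auto simp: less_Suc_eq)

lemma opair_mem_tuple: "i < k \<Longrightarrow> E (opair E (num E i) x) (tuple E \<rho> k) \<longleftrightarrow> x = \<rho> i"
  by (auto simp: mem_tuple)

lemma vapp_tuple [simp]: "i < k \<Longrightarrow> vapp E (tuple E \<rho> k) (num E i) = \<rho> i"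
  by (simp add: vapp_def opair_mem_tuple)

lemma fun_into_tuple: "(\<And>i. i < k \<Longrightarrow> E (\<rho> i) M) \<Longrightarrow> fun_into E (num E k) M (tuple E \<rho> k)"
  unfolding fun_into_def
proof (intro conjI allI impI)
  fix z
  assume M: "\<And>i. i < k \<Longrightarrow> E (\<rho> i) M" and "E z (tuple E \<rho> k)"
  then obtain i where "i < k" "z = opair E (num E i) (\<rho> i)" by (auto simp: mem_tuple)
  then show "\<exists>i x. E i (num E k) \<and> E x M \<and> z = opair E i x"
    using M num_mem_num by blast
next
  fix i assume "E i (num E k)"
  then obtain m where "m < k" "i = num E m" by (auto simp: mem_num)
  then show "\<exists>!x. E (opair E i x) (tuple E \<rho> k)" by (simp add: opair_mem_tuple)
qed

lemma fun_into_vapp: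
  assumes "fun_into E d M s" and "E i d"
  shows "E (opair E i x) s \<longleftrightarrow> x = vapp E s i" and "E (vapp E s i) M"
proof -
  have ex1: "\<exists>!x. E (opair E i x) s" using assms by (simp add: fun_into_def)
  then have mem: "E (opair E i (vapp E s i)) s" unfolding vapp_def by (rule theI')
  then show "E (opair E i x) s \<longleftrightarrow> x = vapp E s i" using ex1 by blast
  show "E (vapp E s i) M" using mem assms(1) by (auto simp: fun_into_def)
qed

text \<open>By \<open>mem_num\<close> all arguments are standard numerals, so the external sequence
  of values determines the function.\<close>

lemma fun_into_num_eq_tuple:
  assumes s: "fun_into E (num E k) M s"
  shows "s = tuple E (\<lambda>i. vapp E s (num E i)) k"
proof (rule extensionality)
  fix u
  have "\<exists>i<k. \<exists>x. u = opair E (num E i) x" if u: "E u s"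
  proof -
    obtain i x where "E i (num E k)" "u = opair E i x"
      using s u unfolding fun_into_def by blast
    then show ?thesis by (auto simp: mem_num)
  qed
  moreover have "E (opair E (num E i) x) s \<longleftrightarrow> x = vapp E s (num E i)" if "i < k" for i x
    by (rule fun_into_vapp(1)[OF s num_mem_num[OF that]])
  ultimately show "E u s \<longleftrightarrow> E u (tuple E (\<lambda>i. vapp E s (num E i)) k)"
    unfolding mem_tuple by metis
qed

section \<open>Codes of metatheoretic formulas\<close>

lemmas code_defs = cMem_def cEq_def cNeg_def cAnd_def cEx_def

text \<open>The constructors carry distinct numerals as tags. Removing \<open>num.simps\<close>
  keeps these numerals folded, so that \<open>num_eq_iff\<close> can compare them.\<close>

lemma quote_eq_iff [simp]: "quote E p = quote E q \<longleftrightarrow> p = q"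
proof (induction p arbitrary: q)
  case (FMem i j) show ?case by (cases q) (auto simp: code_defs simp del: num.simps)
next
  case (FEq i j) show ?case by (cases q) (auto simp: code_defs simp del: num.simps)
next
  case (FNeg p) then show ?case by (cases q) (auto simp: code_defs simp del: num.simps)
next
  case (FAnd p1 p2) then show ?case by (cases q) (auto simp: code_defs simp del: num.simps)
next
  case (FEx i p) then show ?case by (cases q) (auto simp: code_defs simp del: num.simps)
qed

lemma quote_eq_cMem: "quote E p = cMem E i j \<longleftrightarrow> (\<exists>a b. p = FMem a b \<and> i = num E a \<and> j = num E b)"
  by (cases p) (auto simp: code_defs simp del: num.simps)

lemma quote_eq_cEq: "quote E p = cEq E i j \<longleftrightarrow> (\<exists>a b. p = FEq a b \<and> i = num E a \<and> j = num E b)"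
  by (cases p) (auto simp: code_defs simp del: num.simps)

lemma quote_eq_cNeg: "quote E p = cNeg E x \<longleftrightarrow> (\<exists>q. p = FNeg q \<and> x = quote E q)"
  by (cases p) (auto simp: code_defs simp del: num.simps)

lemma quote_eq_cAnd:
  "quote E p = cAnd E x y \<longleftrightarrow> (\<exists>q r. p = FAnd q r \<and> x = quote E q \<and> y = quote E r)"
  by (cases p) (auto simp: code_defs simp del: num.simps)

lemma quote_eq_cEx:
  "quote E p = cEx E i x \<longleftrightarrow> (\<exists>a q. p = FEx a q \<and> i = num E a \<and> x = quote E q)"
  by (cases p) (auto simp: code_defs simp del: num.simps)

text \<open>The internal formation sequence is the tuple of codes of \<open>subfms p\<close>. Its
  length is standard, so every internal position is the numeral of an index into that list.\<close>

lemma formula_over_quote: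
  assumes "var_bound p \<le> k"
  shows "formula_over E (num E k) (quote E p)"
proof -
  obtain L' where L': "subfms p = L' @ [p]" using subfms_snoc by blast
  define L where "L = subfms p"
  define f where "f = tuple E (\<lambda>i. quote E (L ! i)) (length L)"
  have len: "length L = Suc (length L')" and last: "L ! length L' = p"
    by (simp_all add: L_def L')
  have form: "formation k L" unfolding L_def by (rule formation_subfms[OF assms])
  \<comment> \<open>\<open>fun_on\<close> asks for a set containing all values; the finite set of
    codes serves.\<close>
  obtain m where m: "\<forall>u. E u m \<longleftrightarrow> u \<in> set (map (quote E) L)"
    using finite_set_exists by blast
  have "fun_into E (num E (length L)) m f"
    unfolding f_def by (rule fun_into_tuple) (simp add: m)
  then have fon: "fun_on E (vsucc E (num E (length L'))) f"
    unfolding fun_on_def using len by auto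
  have app: "vapp E f (num E i) = quote E (L ! i)" if "i < length L" for i
    using that by (simp add: f_def)
  show ?thesis
    unfolding formula_over_def
  proof (intro exI conjI allI impI)
    show "E (num E (length L')) (omega E)" by (rule num_in_omega)
    show "fun_on E (vsucc E (num E (length L'))) f" by (rule fon)
    show "vapp E f (num E (length L')) = quote E p" using app len last by simp
    fix c assume "E c (vsucc E (num E (length L')))"
    then have "E c (num E (length L))" using len by simp
    then obtain a where a: "a < length L" "c = num E a" by (auto simp: mem_num)
    have earlier: "\<exists>b. E b c \<and> vapp E f b = quote E q" if q: "q \<in> set (take a L)" for q
    proof -
      obtain b where "b < a" "L ! b = q"
        using a q by (auto simp: in_set_conv_nth)
      then show ?thesis using a app[of b] by (intro exI[of _ "num E b"]) (simp add: mem_num_num)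
    qed
    have b: "built_from k (set (take a L)) (L ! a)" using form a by (simp add: formation_def)
    show "(\<exists>i j. E i (num E k) \<and> E j (num E k) \<and> vapp E f c = cMem E i j) \<or>
       (\<exists>i j. E i (num E k) \<and> E j (num E k) \<and> vapp E f c = cEq E i j) \<or>
       (\<exists>a. E a c \<and> vapp E f c = cNeg E (vapp E f a)) \<or>
       (\<exists>a b. E a c \<and> E b c \<and> vapp E f c = cAnd E (vapp E f a) (vapp E f b)) \<or>
       (\<exists>i a. E i (num E k) \<and> E a c \<and> vapp E f c = cEx E i (vapp E f a))"
    proof (cases "L ! a")
      case (FMem i j)
      then have "\<exists>i j. E i (num E k) \<and> E j (num E k) \<and> vapp E f c = cMem E i j"
        using a app[of a] b
        by (intro exI[of _ "num E i"] exI[of _ "num E j"]) (simp add: mem_num_num)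
      then show ?thesis by blast
    next
      case (FEq i j)
      then have "\<exists>i j. E i (num E k) \<and> E j (num E k) \<and> vapp E f c = cEq E i j"
        using a app[of a] b
        by (intro exI[of _ "num E i"] exI[of _ "num E j"]) (simp add: mem_num_num)
      then show ?thesis by blast
    next
      case (FNeg q)
      then have "\<exists>d. E d c \<and> vapp E f c = cNeg E (vapp E f d)"
        using a app[of a] b earlier[of q] by auto
      then show ?thesis by blast
    next
      case (FAnd q r)
      then obtain d e where "E d c" "vapp E f d = quote E q" "E e c" "vapp E f e = quote E r"
        using b earlier[of q] earlier[of r] by auto
      then have "\<exists>d e. E d c \<and> E e c \<and> vapp E f c = cAnd E (vapp E f d) (vapp E f e)"
        using a app[of a] FAnd by (intro exI[of _ d] exI[of _ e]) simp
      then show ?thesis by blast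
    next
      case (FEx i q)
      then obtain d where "E d c" "vapp E f d = quote E q"
        using b earlier[of q] by auto
      then have "\<exists>i d. E i (num E k) \<and> E d c \<and> vapp E f c = cEx E i (vapp E f d)"
        using a app[of a] FEx b
        by (intro exI[of _ "num E i"] exI[of _ d]) (simp add: mem_num_num)
      then show ?thesis by blast
    qed
  qed
qed

section \<open>Internal satisfaction of metatheoretic formulas\<close>

abbreviation elems :: "'a \<Rightarrow> 'a set" where
  "elems M \<equiv> {x. E x M}"

text \<open>An internal assignment differing from \<open>s\<close> only at \<open>num E i\<close>
  corresponds to an external update at \<open>i\<close>. This settles the quantifier clause both for
  comparing a given satisfaction relation with truth and for constructing one.\<close>

lemma ex_reassigned_iff:
  assumes s: "fun_into E (num E k) M s" and "i < k" and "var_bound p \<le> k"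
  shows "(\<exists>t. fun_into E (num E k) M t \<and>
      (\<forall>j. E j (num E k) \<and> j \<noteq> num E i \<longrightarrow> vapp E t j = vapp E s j) \<and>
      sat_on E (elems M) (\<lambda>j. vapp E t (num E j)) p) \<longleftrightarrow>
    sat_on E (elems M) (\<lambda>j. vapp E s (num E j)) (FEx i p)" (is "?L \<longleftrightarrow> ?R")
proof
  assume ?L
  then obtain t where t: "fun_into E (num E k) M t"
    "\<forall>j. E j (num E k) \<and> j \<noteq> num E i \<longrightarrow> vapp E t j = vapp E s j"
    "sat_on E (elems M) (\<lambda>j. vapp E t (num E j)) p" by blast
  have "sat_on E (elems M) ((\<lambda>j. vapp E s (num E j))(i := vapp E t (num E i))) p"
    by (rule sat_on_cong[THEN iffD1, OF _ t(3)]) (use t(2) assms in \<open>auto simp: mem_num_num\<close>)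
  moreover have "E (vapp E t (num E i)) M"
    using fun_into_vapp(2)[OF t(1)] assms(2) by (simp add: mem_num_num)
  ultimately show ?R by auto
next
  assume ?R
  then obtain x where x: "E x M" "sat_on E (elems M) ((\<lambda>j. vapp E s (num E j))(i := x)) p"
    by auto
  define t where "t = tuple E ((\<lambda>j. vapp E s (num E j))(i := x)) k"
  have "fun_into E (num E k) M t"
    unfolding t_def
    by (rule fun_into_tuple) (use x fun_into_vapp(2)[OF s] in \<open>auto simp: mem_num_num\<close>)
  moreover have "vapp E t j = vapp E s j" if "E j (num E k)" "j \<noteq> num E i" for j
    using that by (auto simp: t_def mem_num)
  moreover have "sat_on E (elems M) (\<lambda>j. vapp E t (num E j)) p"
    by (rule sat_on_cong[THEN iffD1, OF _ x(2)]) (use assms(3) in \<open>auto simp: t_def\<close>)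
  ultimately show ?L by (intro exI[of _ t]) simp
qed

lemma sat_relD:
  assumes "sat_rel E M n F T"
  shows sat_rel_cMem: "E i n \<Longrightarrow> E j n \<Longrightarrow> E (cMem E i j) F \<Longrightarrow> fun_into E n M s \<Longrightarrow>
      E (opair E (cMem E i j) s) T \<longleftrightarrow> E (vapp E s i) (vapp E s j)"
    and sat_rel_cEq: "E i n \<Longrightarrow> E j n \<Longrightarrow> E (cEq E i j) F \<Longrightarrow> fun_into E n M s \<Longrightarrow>
      E (opair E (cEq E i j) s) T \<longleftrightarrow> vapp E s i = vapp E s j"
    and sat_rel_cNeg: "E (cNeg E p) F \<Longrightarrow> E p F \<and> (\<forall>s. fun_into E n M s \<longrightarrow>
      (E (opair E (cNeg E p) s) T \<longleftrightarrow> \<not> E (opair E p s) T))"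
    and sat_rel_cAnd: "E (cAnd E p q) F \<Longrightarrow> E p F \<and> E q F \<and> (\<forall>s. fun_into E n M s \<longrightarrow>
      (E (opair E (cAnd E p q) s) T \<longleftrightarrow> E (opair E p s) T \<and> E (opair E q s) T))"
    and sat_rel_cEx: "E i n \<Longrightarrow> E (cEx E i p) F \<Longrightarrow> E p F \<and> (\<forall>s. fun_into E n M s \<longrightarrow>
      (E (opair E (cEx E i p) s) T \<longleftrightarrow> (\<exists>t. fun_into E n M t \<and>
        (\<forall>j. E j n \<and> j \<noteq> i \<longrightarrow> vapp E t j = vapp E s j) \<and> E (opair E p t) T)))"
proof -
  note clauses = assms[unfolded sat_rel_def]
  note c1 = conjunct1[OF clauses] and r1 = conjunct2[OF clauses]
  note c2 = conjunct1[OF r1] and r2 = conjunct2[OF r1]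
  note c3 = conjunct1[OF r2] and r3 = conjunct2[OF r2]
  note c4 = conjunct1[OF r3] and c5 = conjunct2[OF r3]
  show "E i n \<Longrightarrow> E j n \<Longrightarrow> E (cMem E i j) F \<Longrightarrow> fun_into E n M s \<Longrightarrow>
      E (opair E (cMem E i j) s) T \<longleftrightarrow> E (vapp E s i) (vapp E s j)"
    by (rule c1[rule_format]) (intro conjI)
  show "E i n \<Longrightarrow> E j n \<Longrightarrow> E (cEq E i j) F \<Longrightarrow> fun_into E n M s \<Longrightarrow>
      E (opair E (cEq E i j) s) T \<longleftrightarrow> vapp E s i = vapp E s j"
    by (rule c2[rule_format]) (intro conjI)
  show "E (cNeg E p) F \<Longrightarrow> E p F \<and> (\<forall>s. fun_into E n M s \<longrightarrow>
      (E (opair E (cNeg E p) s) T \<longleftrightarrow> \<not> E (opair E p s) T))"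
    by (rule c3[THEN spec, THEN mp])
  show "E (cAnd E p q) F \<Longrightarrow> E p F \<and> E q F \<and> (\<forall>s. fun_into E n M s \<longrightarrow>
      (E (opair E (cAnd E p q) s) T \<longleftrightarrow> E (opair E p s) T \<and> E (opair E q s) T))"
    by (rule c4[THEN spec, THEN spec, THEN mp])
  show "E i n \<Longrightarrow> E (cEx E i p) F \<Longrightarrow> E p F \<and> (\<forall>s. fun_into E n M s \<longrightarrow>
      (E (opair E (cEx E i p) s) T \<longleftrightarrow> (\<exists>t. fun_into E n M t \<and>
        (\<forall>j. E j n \<and> j \<noteq> i \<longrightarrow> vapp E t j = vapp E s j) \<and> E (opair E p t) T)))"
    by (rule c5[THEN spec, THEN spec, THEN mp]) (rule conjI)
qed

text \<open>The clauses of \<open>sat_rel\<close> put the codes of immediate subformulas into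
  \<open>F\<close> as well, so induction on \<open>p\<close> goes through. Hence all choices of
  \<open>F\<close> and \<open>T\<close> in \<open>sat_in\<close> agree on standard codes.\<close>

lemma sat_rel_iff_sat_on:
  assumes "sat_rel E M (num E k) F T"
  shows "E (quote E p) F \<Longrightarrow> var_bound p \<le> k \<Longrightarrow> fun_into E (num E k) M s \<Longrightarrow>
    E (opair E (quote E p) s) T \<longleftrightarrow> sat_on E (elems M) (\<lambda>i. vapp E s (num E i)) p"
proof (induction p arbitrary: s)
  case (FMem i j)
  then show ?case using sat_rel_cMem[OF assms] by (simp add: mem_num_num)
next
  case (FEq i j)
  then show ?case using sat_rel_cEq[OF assms] by (simp add: mem_num_num)
next
  case (FNeg p)
  then have "E (cNeg E (quote E p)) F" by simp
  note p = sat_rel_cNeg[OF assms this]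
  show ?case using FNeg.IH[of s] FNeg.prems(2,3) p by simp
next
  case (FAnd p q)
  then have "E (cAnd E (quote E p) (quote E q)) F" by simp
  note p = sat_rel_cAnd[OF assms this]
  show ?case using FAnd.IH(1)[of s] FAnd.IH(2)[of s] FAnd.prems(2,3) p by simp
next
  case (FEx i p)
  then have i: "i < k" "var_bound p \<le> k" by auto
  have "E (cEx E (num E i) (quote E p)) F" using FEx.prems by simp
  note cl = sat_rel_cEx[OF assms num_mem_num[OF i(1)] this]
  have p: "E (quote E p) F" using cl by (rule conjunct1)
  have "E (opair E (quote E (FEx i p)) s) T \<longleftrightarrow>
      (\<exists>t. fun_into E (num E k) M t \<and>
        (\<forall>j. E j (num E k) \<and> j \<noteq> num E i \<longrightarrow> vapp E t j = vapp E s j) \<and>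
        E (opair E (quote E p) t) T)"
    unfolding quote.simps
    using FEx.prems(3) by (rule conjunct2[OF cl, THEN spec, THEN mp])
  also have "\<dots> \<longleftrightarrow> (\<exists>t. fun_into E (num E k) M t \<and>
        (\<forall>j. E j (num E k) \<and> j \<noteq> num E i \<longrightarrow> vapp E t j = vapp E s j) \<and>
        sat_on E (elems M) (\<lambda>j. vapp E t (num E j)) p)"
    by (simp only: FEx.IH[OF p i(2)] cong: conj_cong)
  finally show ?case unfolding ex_reassigned_iff[OF FEx.prems(3) i] .
qed

lemma sat_in_imp_sat_on:
  assumes "sat_in E M (num E k) (quote E p) s" and "var_bound p \<le> k"
    and "fun_into E (num E k) M s"
  shows "sat_on E (elems M) (\<lambda>i. vapp E s (num E i)) p"
proof -
  obtain F T where "sat_rel E M (num E k) F T" "E (quote E p) F" "E (opair E (quote E p) s) T"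
    using assms(1) unfolding sat_in_def by (elim exE conjE)
  then show ?thesis using sat_rel_iff_sat_on assms(2,3) by simp
qed

section \<open>Closure of models under tuples\<close>

lemma model_transitive: "is_model E M \<Longrightarrow> E y M \<Longrightarrow> E x y \<Longrightarrow> E x M"
  by (auto simp: is_model_def vsubset_def)

text \<open>Only the passage from internal satisfaction to truth is used here. The converse relies
  on existence of satisfaction relations, whose proof needs the closure properties derived from this
  lemma.\<close>

lemma model_sat_on_axiom:
  assumes M: "is_model E M" and "p \<in> ZFC_single"
  shows "\<exists>\<rho>. sat_on E (elems M) \<rho> p"
proof -
  obtain a where a: "E a M" using M by (auto simp: is_model_def)
  \<comment> \<open>Any assignment will do; a constant one exists because models are
    nonempty.\<close>
  define s where "s = tuple E (\<lambda>_. a) (var_bound p)"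
  have s: "fun_into E (num E (var_bound p)) M s"
    unfolding s_def by (rule fun_into_tuple) (rule a)
  have "sat_closure E M (quote E p)"
    using assms by (auto simp: is_model_def ZFC_axiom_def)
  then have "sat_in E M (num E (var_bound p)) (quote E p) s"
    using s by (auto simp: sat_closure_def num_in_omega formula_over_quote)
  from sat_in_imp_sat_on[OF this _ s] show ?thesis by blast
qed

lemma vempty_in_model:
  assumes M: "is_model E M"
  shows "E (vempty E) M"
proof -
  have "ax_infinity \<in> ZFC_single" by (simp add: ZFC_single_def)
  then obtain \<rho> where "sat_on E (elems M) \<rho> ax_infinity"
    using model_sat_on_axiom[OF M] by blast
  then obtain w where
    "sat_on E (elems M) (\<rho>(0 := w)) (FEx 1 (FAnd (FMem 1 0) (FAll 2 (FNeg (FMem 2 1)))))"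
    unfolding ax_infinity_def sat_on.simps(4)[of _ _ _ "FEx _ _"] sat_on.simps(5)[of _ _ _ 0]
    by (elim bexE conjE)
  then obtain e where e: "E e M" "\<And>u. E u M \<Longrightarrow> \<not> E u e" by auto
  \<comment> \<open>So far \<open>e\<close> is empty only as seen from \<open>M\<close>;
    transitivity makes it empty in the universe.\<close>
  have "\<not> E u e" for u
    using e(2) model_transitive[OF M e(1)] by blast
  then have "e = vempty E" by (intro extensionality) simp
  then show ?thesis using e(1) by simp
qed

lemma vpair_in_model:
  assumes M: "is_model E M" and "E x M" "E y M"
  shows "E (vpair E x y) M"
proof -
  have "ax_pair \<in> ZFC_single" by (simp add: ZFC_single_def)
  then obtain \<rho> where "sat_on E (elems M) \<rho> ax_pair"
    using model_sat_on_axiom[OF M] by blast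
  then have "\<forall>x\<in>elems M. \<forall>y\<in>elems M. \<exists>z\<in>elems M. \<forall>u\<in>elems M. E u z \<longleftrightarrow> u = x \<or> u = y"
    by (simp add: ax_pair_def)
  then obtain z where z: "E z M" "\<forall>u\<in>elems M. E u z \<longleftrightarrow> u = x \<or> u = y"
    using assms by blast
  have "E u z \<longleftrightarrow> u = x \<or> u = y" for u
    using z(2) model_transitive[OF M z(1), of u] assms(2,3) by blast
  then have "z = vpair E x y" by (intro extensionality) simp
  then show ?thesis using z(1) by simp
qed

text \<open>The set \<open>{x} \<union> a\<close> is the union of the pair of \<open>{x}\<close> and
  \<open>a\<close>, so pairing and union in \<open>M\<close> suffice.\<close>

lemma vinsert_in_model:
  assumes M: "is_model E M" and "E x M" "E a M"
  shows "E (vinsert E x a) M"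
proof -
  have "ax_union \<in> ZFC_single" by (simp add: ZFC_single_def)
  then obtain \<rho> where "sat_on E (elems M) \<rho> ax_union"
    using model_sat_on_axiom[OF M] by blast
  then have "\<forall>x\<in>elems M. \<exists>z\<in>elems M. \<forall>u\<in>elems M. E u z \<longleftrightarrow> (\<exists>y\<in>elems M. E y x \<and> E u y)"
    by (simp add: ax_union_def)
  moreover have p: "E (vpair E (vpair E x x) a) M" "E (vpair E x x) M"
    using assms vpair_in_model by blast+
  ultimately obtain z where z: "E z M" "\<forall>u\<in>elems M. E u z \<longleftrightarrow>
      (\<exists>y\<in>elems M. E y (vpair E (vpair E x x) a) \<and> E u y)"
    by blast
  have "(\<exists>y\<in>elems M. E y (vpair E (vpair E x x) a) \<and> E u y) \<longleftrightarrow> u = x \<or> E u a" for u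
    using p(2) assms(3) by auto
  then have "E u z \<longleftrightarrow> u = x \<or> E u a" for u
    using z(2) model_transitive[OF M z(1), of u] model_transitive[OF M assms(3), of u] assms(2)
    by blast
  then have "z = vinsert E x a" by (intro extensionality) simp
  with z(1) show ?thesis by simp
qed

lemma num_in_model: "is_model E M \<Longrightarrow> E (num E n) M"
  by (induction n) (simp_all add: vempty_in_model vinsert_in_model vsucc_def)

lemma tuple_in_model: "is_model E M \<Longrightarrow> (\<And>i. i < k \<Longrightarrow> E (\<rho> i) M) \<Longrightarrow> E (tuple E \<rho> k) M"
  by (induction k)
    (simp_all add: vempty_in_model vinsert_in_model opair_def vpair_in_model num_in_model)

text \<open>Without a power set axiom there need be no set of all assignments. This lemma lets
  \<open>M\<close> itself be the set from which assignments are separated.\<close>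

lemma fun_into_num_in_model:
  assumes "is_model E M" and "fun_into E (num E k) M s"
  shows "E s M"
  using fun_into_vapp(2)[OF assms(2)] fun_into_num_eq_tuple[OF assms(2)]
    tuple_in_model[OF assms(1), of k "\<lambda>i. vapp E s (num E i)"]
  by (auto simp: mem_num_num)

section \<open>Existence of satisfaction relations\<close>

definition vpair_fm :: "nat \<Rightarrow> nat \<Rightarrow> nat \<Rightarrow> nat \<Rightarrow> fm" where
  "vpair_fm v z x y = FAnd (FMem x z) (FAnd (FMem y z)
     (FNeg (FEx v (FAnd (FMem v z) (FAnd (FNeg (FEq v x)) (FNeg (FEq v y)))))))"

lemma bounded_vpair_fm: "v \<noteq> z \<Longrightarrow> bounded_fm (vpair_fm v z x y)"
  unfolding vpair_fm_def by (intro bounded_fm.intros)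

lemma sat_vpair_fm:
  assumes "v \<noteq> x" "v \<noteq> y" "v \<noteq> z"
  shows "sat E \<rho> (vpair_fm v z x y) \<longleftrightarrow> \<rho> z = vpair E (\<rho> x) (\<rho> y)"
proof
  assume "sat E \<rho> (vpair_fm v z x y)"
  then show "\<rho> z = vpair E (\<rho> x) (\<rho> y)"
    using assms by (intro extensionality) (auto simp: vpair_fm_def)
next
  assume "\<rho> z = vpair E (\<rho> x) (\<rho> y)"
  then show "sat E \<rho> (vpair_fm v z x y)"
    using assms by (auto simp: vpair_fm_def)
qed

text \<open>The ordered pair is sought in \<open>s\<close>, and \<open>{x}\<close> and
  \<open>{x, y}\<close> are sought inside the pair, which keeps all quantifiers bounded. The
  variables from \<open>v\<close> on are auxiliary.\<close>

definition opair_mem_fm :: "nat \<Rightarrow> nat \<Rightarrow> nat \<Rightarrow> nat \<Rightarrow> fm" where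
  "opair_mem_fm v x y s = FEx v (FAnd (FMem v s)
     (FEx (v + 1) (FAnd (FMem (v + 1) v) (FEx (v + 2) (FAnd (FMem (v + 2) v)
       (FAnd (vpair_fm (v + 3) (v + 1) x x) (FAnd (vpair_fm (v + 3) (v + 2) x y)
         (vpair_fm (v + 3) v (v + 1) (v + 2)))))))))"

lemma bounded_opair_mem_fm: "s < v \<Longrightarrow> bounded_fm (opair_mem_fm v x y s)"
  unfolding opair_mem_fm_def by (intro bounded_fm.intros bounded_vpair_fm) auto

lemma sat_opair_mem_fm:
  assumes "x < v" "y < v" "s < v"
  shows "sat E \<rho> (opair_mem_fm v x y s) \<longleftrightarrow> E (opair E (\<rho> x) (\<rho> y)) (\<rho> s)"
  using assms by (auto simp: opair_mem_fm_def sat_vpair_fm opair_def)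

text \<open>
  \<open>p\<close> under the assignment \<open>s\<close>, for the variables below \<open>j \<le> k\<close>: the variables
  \<open>k\<close>, \<open>k + 1\<close>, \<open>k + 2 + i\<close> denote \<open>M\<close>, \<open>s\<close>, and the numeral of \<open>i\<close>.
\<close>

primrec assigned_fm :: "nat \<Rightarrow> nat \<Rightarrow> fm \<Rightarrow> fm" where
  "assigned_fm k 0 p = p"
| "assigned_fm k (Suc j) p = FEx j (FAnd (FMem j k)
     (FAnd (opair_mem_fm (2 * k + 2) (k + 2 + j) j (k + 1)) (assigned_fm k j p)))"

lemma bounded_assigned_fm: "bounded_fm p \<Longrightarrow> j \<le> k \<Longrightarrow> bounded_fm (assigned_fm k j p)"
  by (induction j) (auto intro!: bounded_fm.intros bounded_opair_mem_fm)

text \<open>Each quantifier has exactly one witness, the value of \<open>s\<close> at the numeral of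
  \<open>j\<close>. The auxiliary variables start at \<open>2 * k + 2\<close>, just above the
  parameters, so nothing is captured.\<close>

lemma sat_assigned_fm:
  assumes s: "fun_into E (num E k) M s"
  shows "j \<le> k \<Longrightarrow> \<rho> k = M \<Longrightarrow> \<rho> (k + 1) = s \<Longrightarrow> (\<And>i. i < k \<Longrightarrow> \<rho> (k + 2 + i) = num E i) \<Longrightarrow>
    sat E \<rho> (assigned_fm k j p) \<longleftrightarrow>
    sat E (\<lambda>i. if i < j then vapp E s (num E i) else \<rho> i) p"
proof (induction j arbitrary: \<rho>)
  case (Suc j)
  let ?x = "vapp E s (num E j)"
  have x: "E (opair E (num E j) x) s \<longleftrightarrow> x = ?x" "E ?x M" for x
    using fun_into_vapp[OF s] Suc.prems(1) by (simp_all add: mem_num_num)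
  have "sat E \<rho> (assigned_fm k (Suc j) p) \<longleftrightarrow> sat E (\<rho>(j := ?x)) (assigned_fm k j p)"
    using Suc.prems(1-3) Suc.prems(4)[of j] x by (auto simp: sat_opair_mem_fm)
  also have "\<dots> \<longleftrightarrow> sat E (\<lambda>i. if i < j then vapp E s (num E i) else (\<rho>(j := ?x)) i) p"
    by (rule Suc.IH) (use Suc.prems in auto)
  also have "(\<lambda>i. if i < j then vapp E s (num E i) else (\<rho>(j := ?x)) i) =
      (\<lambda>i. if i < Suc j then vapp E s (num E i) else \<rho> i)"
    by (auto simp: less_Suc_eq)
  finally show ?case .
qed simp

text \<open>Truth of \<open>p\<close> under \<open>s\<close> is a bounded property of
  \<open>s\<close> with \<open>M\<close> and finitely many numerals as parameters, so separation
  from \<open>M\<close> applies. Members of \<open>S\<close> that are not assignments do not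
  matter.\<close>

lemma truth_set_exists:
  assumes M: "is_model E M" and p: "var_bound p \<le> k"
  shows "\<exists>S. \<forall>s. fun_into E (num E k) M s \<longrightarrow>
    (E s S \<longleftrightarrow> sat_on E (elems M) (\<lambda>i. vapp E s (num E i)) p)"
proof -
  \<comment> \<open>Variable \<open>k\<close> denotes \<open>M\<close> and \<open>k + 2 + i\<close>
    the numeral of \<open>i\<close>; separation fills in \<open>k + 1\<close>. The values below
    \<open>k\<close> are arbitrary, as \<open>q\<close> rebinds these variables.\<close>
  define \<rho> where "\<rho> = (\<lambda>i. if i = k then M else num E (i - (k + 2)))"
  define q where "q = assigned_fm k k (relativize k p)"
  have "bounded_fm q"
    unfolding q_def by (intro bounded_assigned_fm bounded_fm_relativize) (simp_all add: p)
  from separation[OF this] obtain S where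
    S: "\<forall>u. E u S \<longleftrightarrow> E u M \<and> sat E (\<rho>(k + 1 := u)) q" by blast
  have "E s S \<longleftrightarrow> sat_on E (elems M) (\<lambda>i. vapp E s (num E i)) p"
    if s: "fun_into E (num E k) M s" for s
  proof -
    let ?\<sigma> = "\<lambda>i. if i < k then vapp E s (num E i) else (\<rho>(k + 1 := s)) i"
    have "E s S \<longleftrightarrow> sat E (\<rho>(k + 1 := s)) q"
      using S fun_into_num_in_model[OF M s] by simp
    also have "\<dots> \<longleftrightarrow> sat E ?\<sigma> (relativize k p)"
      unfolding q_def by (rule sat_assigned_fm[OF s]) (auto simp: \<rho>_def)
    also have "\<dots> \<longleftrightarrow> sat_on E {x. E x (?\<sigma> k)} ?\<sigma> p"
      by (rule sat_relativize[OF p])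
    also have "?\<sigma> k = M" by (simp add: \<rho>_def)
    also have "sat_on E (elems M) ?\<sigma> p \<longleftrightarrow> sat_on E (elems M) (\<lambda>i. vapp E s (num E i)) p"
      by (rule sat_on_cong) (use p in simp)
    finally show ?thesis .
  qed
  then show ?thesis by blast
qed

text \<open>A finite union of products \<open>{c x} \<times> S x\<close>; it glues the truth sets of
  single formulas into one relation.\<close>

lemma tagged_union_exists:
  "\<exists>T. \<forall>z. E z T \<longleftrightarrow> (\<exists>x\<in>set xs. \<exists>s. E s (S x) \<and> z = opair E (c x) s)"
proof (induction xs)
  case Nil
  show ?case by (rule exI[of _ "vempty E"]) simp
next
  case (Cons x xs)
  then obtain T where T: "\<forall>z. E z T \<longleftrightarrow> (\<exists>x\<in>set xs. \<exists>s. E s (S x) \<and> z = opair E (c x) s)"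
    by blast
  obtain P where P: "\<forall>u. E u P \<longleftrightarrow> (\<exists>a b. E a (vpair E (c x) (c x)) \<and> E b (S x) \<and> u = opair E a b)"
    using product_exists by blast
  obtain U where "\<forall>u. E u U \<longleftrightarrow> E u P \<or> E u T" using binary_union_exists by blast
  then show ?case using P T by (intro exI[of _ U]) auto
qed

text \<open>\<open>F\<close> consists of the codes of the finitely many subformulas, and
  \<open>T\<close> attaches to each code its truth set. The inversion rules for \<open>quote\<close>
  turn a compound code in \<open>F\<close> back into a subformula.\<close>

lemma sat_rel_exists:
  assumes M: "is_model E M" and p: "var_bound p \<le> k"
  shows "\<exists>F T. sat_rel E M (num E k) F T \<and> E (quote E p) F"
proof -
  let ?L = "set (subfms p)"
  let ?sat = "\<lambda>q s. sat_on E (elems M) (\<lambda>i. vapp E s (num E i)) q"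
  have bound: "var_bound q \<le> k" if "q \<in> ?L" for q
    using var_bound_subfms[OF that] p by simp
  \<comment> \<open>The condition on \<open>q\<close> stands inside the existential so that a choice
    function defined on all formulas can be extracted.\<close>
  then have "\<forall>q. \<exists>S. q \<in> ?L \<longrightarrow> (\<forall>s. fun_into E (num E k) M s \<longrightarrow> (E s S \<longleftrightarrow> ?sat q s))"
    using truth_set_exists[OF M] by blast
  then obtain S where S: "\<And>q s. q \<in> ?L \<Longrightarrow> fun_into E (num E k) M s \<Longrightarrow> E s (S q) \<longleftrightarrow> ?sat q s"
    by metis
  obtain F where F: "\<forall>u. E u F \<longleftrightarrow> u \<in> set (map (quote E) (subfms p))"
    using finite_set_exists by blast
  obtain T where T: "\<forall>z. E z T \<longleftrightarrow> (\<exists>q\<in>?L. \<exists>s. E s (S q) \<and> z = opair E (quote E q) s)"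
    using tagged_union_exists by blast
  have inF: "E u F \<longleftrightarrow> (\<exists>q\<in>?L. u = quote E q)" for u
    using F by auto
  have inT: "E (opair E (quote E q) s) T \<longleftrightarrow> ?sat q s"
    if "q \<in> ?L" "fun_into E (num E k) M s" for q s
    using T S[OF that] that by auto
  have "sat_rel E M (num E k) F T"
    unfolding sat_rel_def
  proof (intro conjI allI impI; (elim conjE)?)
    fix i j s assume s: "fun_into E (num E k) M s" and "E (cMem E i j) F"
    then obtain a b where q: "FMem a b \<in> ?L" and ij: "i = num E a" "j = num E b"
      using quote_eq_cMem inF by metis
    show "E (opair E (cMem E i j) s) T \<longleftrightarrow> E (vapp E s i) (vapp E s j)"
      using inT[OF q s] by (simp add: ij)
  next
    fix i j s assume s: "fun_into E (num E k) M s" and "E (cEq E i j) F"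
    then obtain a b where q: "FEq a b \<in> ?L" and ij: "i = num E a" "j = num E b"
      using quote_eq_cEq inF by metis
    show "E (opair E (cEq E i j) s) T \<longleftrightarrow> vapp E s i = vapp E s j"
      using inT[OF q s] by (simp add: ij)
  next
    fix x assume "E (cNeg E x) F"
    then obtain q where q: "FNeg q \<in> ?L" and x: "x = quote E q"
      using quote_eq_cNeg inF by metis
    have q': "q \<in> ?L" using subfms_trans[OF q] self_in_subfms by simp
    then show "E x F" using inF x by blast
    fix s assume s: "fun_into E (num E k) M s"
    show "E (opair E (cNeg E x) s) T \<longleftrightarrow> \<not> E (opair E x s) T"
      using inT[OF q s] inT[OF q' s] by (simp add: x)
  next
    fix x y assume "E (cAnd E x y) F"
    then obtain q r where q: "FAnd q r \<in> ?L" and x: "x = quote E q" "y = quote E r"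
      using quote_eq_cAnd inF by metis
    have q': "q \<in> ?L" "r \<in> ?L" using subfms_trans[OF q] self_in_subfms by simp_all
    then show "E x F" "E y F" using inF x by blast+
    fix s assume s: "fun_into E (num E k) M s"
    show "E (opair E (cAnd E x y) s) T \<longleftrightarrow> E (opair E x s) T \<and> E (opair E y s) T"
      using inT[OF q s] inT[OF q'(1) s] inT[OF q'(2) s] by (simp add: x)
  next
    fix i x assume "E (cEx E i x) F"
    then obtain a q where q: "FEx a q \<in> ?L" and x: "i = num E a" "x = quote E q"
      using quote_eq_cEx inF by metis
    have q': "q \<in> ?L" using subfms_trans[OF q] self_in_subfms by simp
    then show "E x F" using inF x by blast
    fix s assume s: "fun_into E (num E k) M s"
    have a: "a < k" "var_bound q \<le> k" using bound[OF q] by auto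
    show "E (opair E (cEx E i x) s) T \<longleftrightarrow> (\<exists>t. fun_into E (num E k) M t \<and>
        (\<forall>j. E j (num E k) \<and> j \<noteq> i \<longrightarrow> vapp E t j = vapp E s j) \<and> E (opair E x t) T)"
      using inT[OF q s] inT[OF q'] ex_reassigned_iff[OF s a] unfolding x quote.simps by metis
  qed
  moreover have "E (quote E p) F" using inF self_in_subfms by blast
  ultimately show ?thesis by blast
qed

section \<open>Agreement of internal satisfaction with relativised truth\<close>

lemma sat_in_iff_sat_on:
  assumes M: "is_model E M" and p: "var_bound p \<le> k" and s: "fun_into E (num E k) M s"
  shows "sat_in E M (num E k) (quote E p) s \<longleftrightarrow> sat_on E (elems M) (\<lambda>i. vapp E s (num E i)) p"
  using sat_in_imp_sat_on[OF _ p s] sat_rel_exists[OF M p] sat_rel_iff_sat_on[OF _ _ p s]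
  unfolding sat_in_def by blast

lemma sat_in_fm_iff_sat_on:
  assumes "is_model E M" and "\<And>i. E (\<rho> i) M"
  shows "sat_in_fm E M \<rho> p \<longleftrightarrow> sat_on E (elems M) \<rho> p"
proof -
  have "sat_in_fm E M \<rho> p \<longleftrightarrow>
      sat_on E (elems M) (\<lambda>i. vapp E (tuple E \<rho> (var_bound p)) (num E i)) p"
    unfolding sat_in_fm_def
    by (rule sat_in_iff_sat_on) (simp_all add: assms fun_into_tuple)
  also have "\<dots> \<longleftrightarrow> sat_on E (elems M) \<rho> p"
    by (rule sat_on_cong) simp
  finally show ?thesis .
qed

text \<open>Internal elementarity covers all codes; here it is applied to the code of a
  metatheoretic formula and a tuple of standard length.\<close>

lemma elem_submodel_sat_on:
  assumes "is_model E M" "is_model E N" "elem_submodel E M N" and \<rho>: "\<And>i. E (\<rho> i) M"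
  shows "sat_on E (elems M) \<rho> p \<longleftrightarrow> sat_on E (elems N) \<rho> p"
proof -
  have "E (\<rho> i) N" for i
    using assms by (auto simp: elem_submodel_def vsubset_def)
  moreover have "sat_in_fm E M \<rho> p \<longleftrightarrow> sat_in_fm E N \<rho> p"
    using assms fun_into_tuple[of "var_bound p" \<rho> M]
    by (simp add: elem_submodel_def sat_in_fm_def num_in_omega formula_over_quote)
  ultimately show ?thesis
    using assms by (simp add: sat_in_fm_iff_sat_on)
qed

section \<open>Strongly extendible models\<close>

lemma model_bounded_absolute:
  assumes "is_model E M" and "bounded_fm p" and "\<And>i. E (\<rho> i) M"
  shows "sat_on E (elems M) \<rho> p \<longleftrightarrow> sat E \<rho> p"
  by (rule bounded_fm_absolute) (use assms model_transitive in auto)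

text \<open>A counterexample in \<open>N\<close> would be one in the universe, since the matrix is
  absolute.\<close>

lemma model_Pi_downward:
  assumes N: "is_model E N" and q: "bounded_fm q" and \<sigma>: "\<And>i. E (\<sigma> i) N"
    and sat: "sat E \<sigma> (FAlls js q)"
  shows "sat_on E (elems N) \<sigma> (FAlls js q)"
proof -
  have "False" if "\<forall>i. i \<notin> set js \<longrightarrow> \<tau> i = \<sigma> i" "\<forall>i\<in>set js. \<tau> i \<in> elems N"
    "\<not> sat_on E (elems N) \<tau> q" for \<tau>
  proof -
    have "E (\<tau> i) N" for i using that \<sigma>[of i] by (cases "i \<in> set js") auto
    then have "\<not> sat E \<tau> q" using that model_bounded_absolute[OF N q] by blast
    then show False
      using sat that(1) unfolding sat_on_UNIV[symmetric] sat_on_FAlls sat_on_FExs by auto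
  qed
  then show ?thesis unfolding sat_on_FAlls sat_on_FExs by auto
qed

text \<open>Only the values at the variables in \<open>is\<close> can lie outside \<open>M\<close>.
  They form a finite set, and a transitive \<open>N\<close> having this set as an element contains
  them all.\<close>

lemma strongly_extendible_contains:
  assumes M: "strongly_extendible E M" and \<rho>: "\<And>i. E (\<rho> i) M"
    and \<sigma>: "\<forall>i. i \<notin> set is \<longrightarrow> \<sigma> i = \<rho> i"
  obtains N where "is_model E N" "elem_submodel E M N" "\<And>i. E (\<sigma> i) N"
proof -
  obtain x where x: "\<forall>u. E u x \<longleftrightarrow> u \<in> set (map \<sigma> is)" using finite_set_exists by blast
  obtain N where N: "is_model E N" "E x N" "elem_submodel E M N"
    using M by (auto simp: strongly_extendible_def)
  have "E (\<sigma> i) N" for i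
  proof (cases "i \<in> set is")
    case True
    then have "E (\<sigma> i) x" using x by simp
    then show ?thesis using model_transitive[OF N(1,2)] by blast
  next
    case False
    then show ?thesis using \<sigma> \<rho>[of i] N(3) by (auto simp: elem_submodel_def vsubset_def)
  qed
  with N show ?thesis by (intro that[of N])
qed

text \<open>The universal block may be empty, so this gives the downward direction for both
  \<open>\<Sigma>\<^sub>1\<close> and \<open>\<Sigma>\<^sub>2\<close>.\<close>

lemma strongly_extendible_reflects:
  assumes M: "strongly_extendible E M" and q: "bounded_fm q" and \<rho>: "\<And>i. E (\<rho> i) M"
    and sat: "sat E \<rho> (FExs is (FAlls js q))"
  shows "sat_on E (elems M) \<rho> (FExs is (FAlls js q))"
proof -
  obtain \<sigma> where \<sigma>: "\<forall>i. i \<notin> set is \<longrightarrow> \<sigma> i = \<rho> i" "sat E \<sigma> (FAlls js q)"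
    using sat unfolding sat_on_UNIV[symmetric] sat_on_FExs by auto
  obtain N where N: "is_model E N" "elem_submodel E M N" "\<And>i. E (\<sigma> i) N"
    using strongly_extendible_contains[OF M \<rho> \<sigma>(1)] by metis
  have "sat_on E (elems N) \<rho> (FExs is (FAlls js q))"
    unfolding sat_on_FExs using \<sigma> N model_Pi_downward[OF N(1) q N(3) \<sigma>(2)] by blast
  then show ?thesis
    using elem_submodel_sat_on[OF _ N(1,2) \<rho>] M by (auto simp: strongly_extendible_def)
qed

lemma strongly_extendible_Sigma1:
  assumes M: "strongly_extendible E M" and q: "bounded_fm q" and \<rho>: "\<And>i. E (\<rho> i) M"
  shows "sat_on E (elems M) \<rho> (FExs is q) \<longleftrightarrow> sat E \<rho> (FExs is q)"
proof
  have model: "is_model E M" using M by (simp add: strongly_extendible_def)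
  assume "sat_on E (elems M) \<rho> (FExs is q)"
  then obtain \<sigma> where \<sigma>: "\<forall>i. i \<notin> set is \<longrightarrow> \<sigma> i = \<rho> i" "\<forall>i\<in>set is. E (\<sigma> i) M"
    "sat_on E (elems M) \<sigma> q" unfolding sat_on_FExs by auto
  have "E (\<sigma> i) M" for i using \<sigma>(1,2) \<rho>[of i] by (cases "i \<in> set is") auto
  then have "sat E \<sigma> q" using \<sigma>(3) model_bounded_absolute[OF model q] by blast
  then show "sat E \<rho> (FExs is q)"
    using \<sigma>(1) unfolding sat_on_UNIV[symmetric] sat_on_FExs by auto
next
  assume "sat E \<rho> (FExs is q)"
  then have "sat E \<rho> (FExs is (FAlls [] q))" by (simp add: FAlls_def)
  from strongly_extendible_reflects[OF M q \<rho> this]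
  show "sat_on E (elems M) \<rho> (FExs is q)" by (simp add: FAlls_def)
qed

lemma strongly_extendible_Sigma2:
  assumes M: "strongly_extendible E M" and q: "bounded_fm q" and \<rho>: "\<And>i. E (\<rho> i) M"
  shows "sat_on E (elems M) \<rho> (FExs is (FAlls js q)) \<longleftrightarrow> sat E \<rho> (FExs is (FAlls js q))"
proof
  assume "sat_on E (elems M) \<rho> (FExs is (FAlls js q))"
  then obtain \<sigma> where \<sigma>: "\<forall>i. i \<notin> set is \<longrightarrow> \<sigma> i = \<rho> i" "\<forall>i\<in>set is. E (\<sigma> i) M"
    "sat_on E (elems M) \<sigma> (FAlls js q)" unfolding sat_on_FExs by auto
  have "E (\<sigma> i) M" for i using \<sigma>(1,2) \<rho>[of i] by (cases "i \<in> set is") auto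
  \<comment> \<open>The universal block fails exactly when \<open>FExs js (FNeg q)\<close> holds,
    which is \<open>\<Sigma>\<^sub>1\<close> with parameters in \<open>M\<close>, so
    \<open>M\<close> and the universe agree on it.\<close>
  then have "sat E \<sigma> (FAlls js q)"
    using \<sigma>(3) strongly_extendible_Sigma1[OF M bounded_fm.neg[OF q]]
    unfolding sat_on_UNIV[symmetric] sat_on_FAlls by blast
  then show "sat E \<rho> (FExs is (FAlls js q))"
    using \<sigma>(1) unfolding sat_on_UNIV[symmetric] sat_on_FExs by auto
qed (rule strongly_extendible_reflects[OF M q \<rho>])

lemma strongly_extendible_Sigma_elem_V:
  assumes M: "strongly_extendible E M"
  shows "Sigma_elem_V E 1 M" and "Sigma_elem_V E 2 M"
proof -
  have model: "is_model E M" using M by (simp add: strongly_extendible_def)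
  show "Sigma_elem_V E 1 M"
    unfolding Sigma_elem_V_def Sigma_fm_1
    using sat_in_fm_iff_sat_on[OF model] strongly_extendible_Sigma1[OF M] by blast
  show "Sigma_elem_V E 2 M"
    unfolding Sigma_elem_V_def Sigma_fm_2
    using sat_in_fm_iff_sat_on[OF model] strongly_extendible_Sigma2[OF M] by blast
qed

end

theorem lemma3p9:
  fixes E :: "'a \<Rightarrow> 'a \<Rightarrow> bool"
  assumes "LZFC E"
  shows "(\<forall>M. strongly_extendible E M \<longrightarrow> Sigma_elem_V E 1 M) \<and>
    (LZFC_sext E \<longrightarrow> (\<forall>x. \<exists>M. is_model E M \<and> E x M \<and> Sigma_elem_V E 1 M)) \<and>
    (\<forall>M. strongly_extendible E M \<longrightarrow> Sigma_elem_V E 2 M)"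
proof -
  have "BST E" using assms by (simp add: LZFC_def)
  note elem = strongly_extendible_Sigma_elem_V[OF this]
  show ?thesis
    using elem unfolding LZFC_sext_def Loc_sext_ZFC_def strongly_extendible_def by blast
qed

end
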